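(* Let $n \ge 2$ and let $W = w_1 w_2 \cdots w_m$ (with $m = n^2-2n+4$) be a string generated by Adelman's rule on an alphabet of $n$ letters. Then interchanging the last two letters of $W$ does not affect its completeness: the string $w_1 w_2 \cdots w_{m-2}\, w_m\, w_{m-1}$ is again $\Pi_n$-complete.
   Context: Let $S_n=\{1,\ldots,n\}$. A string $W$ over an alphabet of $n$ letters is called $\Pi_n$-complete if each of the $n!$ permutations of the alphabet (words of length $n$ using each letter exactly once) occurs in $W$ as a (not necessarily contiguous) subsequence. For example, $121$ is $\Pi_2$-complete and $1231213$ is $\Pi_3$-complete. A string $w_1w_2\cdots w_k$ over $\{1,\ldots,r\}$ is an $R_r$-string if $w_{i+1} = (w_i \bmod r) + 1$ for all $1\le i<k$, i.e. its letters run cyclically through $1,2,\ldots,r,1,2,\ldots$. Adelman's rule constructs a string over $S_n$ as follows. (i) Let $T_n$ be the unique $R_{n-1}$-string over $S_{n-1}=\{1,\ldots,n-1\}$ of length $n^2-3n+4$ whose first letter is $1$. (ii) Let $T'_n$ be the string obtained from $T_n$ by inserting, for each $i$ with $1\le i\le n-2$, the letter $n$ immediately after the $i$-th occurrence of the letter $n-i$. (iii) Output the string $n\,T'_n\,n$ (the letter $n$, followed by $T'_n$, followed by the letter $n$), which has length $n^2-2n+4$. For example, for $n=4$: $T_4=12312312$, $T'_4=1234124312$, and the output is $412341243124$. A string over an $n$-letter alphabet is generated by Adelman's rule if it is this output string, up to a bijective renaming of the letters. It is a known result of Adelman that such a string is $\Pi_n$-complete. *)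

theory Defs
  imports Main "HOL-Library.Sublist" "HOL-Combinatorics.Multiset_Permutations"
begin

definition pi_complete :: "'a set \<Rightarrow> 'a list \<Rightarrow> bool" where
  "pi_complete A W \<longleftrightarrow> set W \<subseteq> A \<and> (\<forall>p \<in> permutations_of_set A. subseq p W)"

definition R_string :: "nat \<Rightarrow> nat list \<Rightarrow> bool" where
  "R_string r w \<longleftrightarrow> set w \<subseteq> {1..r} \<and>
     (\<forall>i. Suc i < length w \<longrightarrow> w ! Suc i = w ! i mod r + 1)"

text \<open>Sums are reordered as \<open>n\<^sup>2 + 4 - 3 * n\<close> because subtraction on \<open>nat\<close> truncates:
  \<open>n\<^sup>2 - 3 * n + 4\<close> would be wrong for \<open>n = 2\<close>.\<close>

definition adelman_T :: "nat \<Rightarrow> nat list" where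
  "adelman_T n = (THE w. R_string (n - 1) w \<and> length w = n\<^sup>2 + 4 - 3 * n \<and> hd w = 1)"

text \<open>List positions start at 0, occurrences are counted from 1.\<close>

definition is_occurrence :: "nat \<Rightarrow> 'a \<Rightarrow> 'a list \<Rightarrow> nat \<Rightarrow> bool" where
  "is_occurrence i a w k \<longleftrightarrow> k < length w \<and> w ! k = a \<and> count_list (take (Suc k) w) a = i"

text \<open>All insertions are made simultaneously. Since the inserted letter \<open>n\<close> differs from
  every \<open>n - i\<close>, they do not change the occurrence counts of the letters \<open>n - i\<close>.\<close>

definition adelman_T' :: "nat \<Rightarrow> nat list" where
  "adelman_T' n = (let w = adelman_T n in
     concat (map (\<lambda>k. if \<exists>i \<in> {1..n - 2}. is_occurrence i (n - i) w k then [w ! k, n] else [w ! k])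
       [0..<length w]))"

definition adelman_string :: "nat \<Rightarrow> nat list" where
  "adelman_string n = [n] @ adelman_T' n @ [n]"

definition adelman_generated :: "nat \<Rightarrow> 'a set \<Rightarrow> 'a list \<Rightarrow> bool" where
  "adelman_generated n A W \<longleftrightarrow> (\<exists>f. bij_betw f {1..n} A \<and> W = map f (adelman_string n))"

definition swap_last_two :: "'a list \<Rightarrow> 'a list" where
  "swap_last_two W = take (length W - 2) W @ [W ! (length W - 1), W ! (length W - 2)]"

text \<open>The description in \<open>adelman_T\<close> determines a unique string.\<close>

lemma adelman_T_char:
  assumes "n \<ge> 2"
  shows "R_string (n - 1) w \<and> length w = n\<^sup>2 + 4 - 3 * n \<and> hd w = 1 \<longleftrightarrow>
    w = map (\<lambda>k. k mod (n - 1) + 1) [0..<n\<^sup>2 + 4 - 3 * n]" (is "?P \<longleftrightarrow> w = ?e")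
proof
  have "0 \<le> (int n - 2) * (int n - 1)" using assms by (intro mult_nonneg_nonneg) auto
  then have "int (3 * n) < int (n\<^sup>2 + 4)" by (simp add: algebra_simps power2_eq_square)
  then have pos: "0 < n\<^sup>2 + 4 - 3 * n" by linarith
  {
    assume P: ?P
    have "w ! k = k mod (n - 1) + 1" if "k < length w" for k
      using that
    proof (induction k)
      case 0
      then have "w \<noteq> []" by auto
      with P show ?case using hd_conv_nth[of w] by simp
    next
      case (Suc k)
      then have "w ! Suc k = (k mod (n - 1) + 1) mod (n - 1) + 1"
        using P by (simp add: R_string_def)
      then show ?case by (simp add: mod_Suc_eq)
    qed
    with P show "w = ?e" by (intro nth_equalityI) auto
  next
    assume w: "w = ?e"
    have "R_string (n - 1) w"
      using assms by (auto simp: R_string_def w mod_Suc_eq Suc_le_eq)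
    then show ?P using pos w by (simp add: hd_conv_nth)
  }
qed

lemma adelman_T_eq:
  assumes "n \<ge> 2"
  shows "adelman_T n = map (\<lambda>k. k mod (n - 1) + 1) [0..<n\<^sup>2 + 4 - 3 * n]"
  unfolding adelman_T_def adelman_T_char[OF assms] by simp

lemma "adelman_string 4 = [4,1,2,3,4,1,2,4,3,1,2,4]"
proof -
  have T: "adelman_T 4 = [1,2,3,1,2,3,1,2]"
    by (simp add: adelman_T_eq upt_rec)
  have I: "{1..4 - 2} = {1, 2 :: nat}" by auto
  show ?thesis
    unfolding adelman_string_def adelman_T'_def T I is_occurrence_def Let_def by code_simp
qed

end

theory Submission
  imports Defs
begin

text \<open>
  Write \<open>n = q + 2\<close>, so that the letters other than \<open>n\<close> form a cyclic word over \<open>r = q + 1\<close>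
  letters, of length \<open>q * r + 2\<close>. Computing where the insertions fall shows that after the
  interchange the copies of \<open>n\<close> are spread perfectly evenly: one stands at the very beginning, and
  one directly after each cyclic position \<open>i * q\<close> with \<open>1 \<le> i \<le> r\<close> (positions start at 0).
  The interchange is what produces the copy for \<open>i = r\<close>: it moves the final \<open>n\<close> to the left of the
  last cyclic letter, which has position \<open>r * q + 1\<close>.

  In a cyclic word over \<open>r\<close> letters, the next occurrence of a letter different from the current one
  is at most \<open>r - 1 = q\<close> steps away. Hence a word of \<open>j\<close> distinct letters is a subsequence of
  any \<open>j * q + 1\<close> consecutive letters (\<open>subseq_cyclic_window\<close>). Now split a permutation as
  \<open>xs @ n # ys\<close> with \<open>xs\<close> of length \<open>j\<close>. The word \<open>xs\<close> fits into the cyclic positions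
  \<open>0, \<dots>, j * q\<close>, which are followed by the \<open>j\<close>-th copy of \<open>n\<close> (the leading one
  counts as the 0-th and serves the case \<open>j = 0\<close>). Behind it remain at least
  \<open>(q * r + 2) - (j * q + 1) = (r - j) * q + 1\<close> cyclic letters, exactly the number that suffices
  for the \<open>r - j\<close> letters of \<open>ys\<close>.
\<close>

section \<open>Subsequences of cyclic words\<close>

definition cyclic_letter :: "nat \<Rightarrow> nat \<Rightarrow> nat" where
  "cyclic_letter r k = k mod r + 1"

lemma cyclic_letter_in_window:
  assumes "a \<in> {1..r}"
  shows "\<exists>t. s \<le> t \<and> t < s + r \<and> cyclic_letter r t = a"
proof -
  let ?d = "nat ((int a - 1 - int s) mod int r)"
  have r: "0 < r" using assms by auto
  have "int ((s + ?d) mod r) = (int s + (int a - 1 - int s) mod int r) mod int r"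
    using r by (simp add: zmod_int)
  also have "\<dots> = int (a - 1)"
    using assms by (simp add: mod_add_right_eq)
  finally have "(s + ?d) mod r = a - 1" by linarith
  moreover have "?d < r" using r by (simp add: nat_less_iff)
  ultimately show ?thesis
    using assms by (intro exI[of _ "s + ?d"]) (auto simp: cyclic_letter_def)
qed

text \<open>
  The letter at position \<open>s\<close> stands for the one matched last. Because the next letter to be matched
  differs from it, the search ends at position \<open>s + r - 1\<close> instead of \<open>s + r\<close>, so that each
  letter costs only \<open>r - 1\<close> positions.
\<close>

lemma subseq_cyclic_after:
  assumes "set xs \<subseteq> {1..r}" and "distinct_adj (cyclic_letter r s # xs)"
    and "s + 1 + length xs * (r - 1) \<le> e"
  shows "subseq xs (map (cyclic_letter r) [s + 1..<e])"
  using assms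
proof (induction xs arbitrary: s)
  case Nil
  then show ?case by simp
next
  case (Cons y ys)
  have y: "y \<in> {1..r}" and ne: "cyclic_letter r s \<noteq> y" using Cons.prems by auto
  obtain t where t: "s \<le> t" "t < s + r" "cyclic_letter r t = y"
    using cyclic_letter_in_window[OF y] by blast
  have st: "s < t" using t ne by (cases "s = t") auto
  have te: "t + 1 + length ys * (r - 1) \<le> e" using Cons.prems(3) t by simp
  have "subseq ys (map (cyclic_letter r) [t + 1..<e])"
    using Cons.IH[of t] Cons.prems te t by auto
  moreover have "[s + 1..<e] = [s + 1..<t] @ t # [t + 1..<e]"
  proof -
    have "[s + 1..<e] = [s + 1..<t] @ [t..<e]"
      using st te upt_add_eq_append[of "s + 1" t "e - t"] by simp
    also have "[t..<e] = t # [t + 1..<e]" using te by (simp add: upt_conv_Cons)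
    finally show ?thesis .
  qed
  ultimately show ?case using t by (simp add: list_emb_append2)
qed

lemma subseq_cyclic_window:
  assumes "set xs \<subseteq> {1..r}" and "distinct_adj xs" and "s + length xs * (r - 1) + 1 \<le> e"
  shows "subseq xs (map (cyclic_letter r) [s..<e])"
proof (cases xs)
  case Nil
  then show ?thesis by simp
next
  case (Cons y ys)
  have y: "y \<in> {1..r}" using assms(1) Cons by auto
  obtain t where t: "s \<le> t" "t < s + r" "cyclic_letter r t = y"
    using cyclic_letter_in_window[OF y] by blast
  have te: "t + 1 + length ys * (r - 1) \<le> e" using assms(3) t Cons by simp
  have "subseq ys (map (cyclic_letter r) [t + 1..<e])"
    using subseq_cyclic_after[of ys r t e] assms te t Cons by auto
  moreover have "[s..<e] = [s..<t] @ t # [t + 1..<e]"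
    using t te upt_add_eq_append[of s t "e - t"] by (simp add: upt_conv_Cons)
  ultimately show ?thesis using t Cons by (simp add: list_emb_append2)
qed

section \<open>Words with a separator inserted after marked positions\<close>

definition insert_after :: "'a \<Rightarrow> nat set \<Rightarrow> (nat \<Rightarrow> 'a) \<Rightarrow> nat list \<Rightarrow> 'a list" where
  "insert_after x K c ks = concat (map (\<lambda>k. if k \<in> K then [c k, x] else [c k]) ks)"

lemma insert_after_append [simp]:
  "insert_after x K c (ks @ ls) = insert_after x K c ks @ insert_after x K c ls"
  by (simp add: insert_after_def)

lemma insert_after_Nil [simp]: "insert_after x K c [] = []"
  by (simp add: insert_after_def)

lemma insert_after_Cons [simp]:
  "insert_after x K c (k # ks) =
    (if k \<in> K then c k # x # insert_after x K c ks else c k # insert_after x K c ks)"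
  by (simp add: insert_after_def)

lemma insert_after_cong:
  assumes "\<And>k. k \<in> set ks \<Longrightarrow> k \<in> K \<longleftrightarrow> k \<in> K'" and "\<And>k. k \<in> set ks \<Longrightarrow> c k = c' k"
  shows "insert_after x K c ks = insert_after x K' c' ks"
  using assms by (induction ks) auto

lemma set_insert_after_subset: "set (insert_after x K c ks) \<subseteq> insert x (c ` set ks)"
  by (induction ks) auto

lemma subseq_map_insert_after: "subseq (map c ks) (insert_after x K c ks)"
  by (induction ks) auto

section \<open>The shape of the string after the interchange\<close>

lemma count_cyclic_letter:
  assumes "s < r"
  shows "count_list (map (cyclic_letter r) [0..<N]) (s + 1) = N div r + (if s < N mod r then 1 else 0)"
proof (induction N)
  case 0
  then show ?case by simp
next
  case (Suc N)
  have "N mod r < r" using assms by simp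
  then show ?case
    using Suc assms by (auto simp: cyclic_letter_def div_Suc mod_Suc)
qed

lemma count_cyclic_letter_self:
  assumes "0 < r"
  shows "count_list (map (cyclic_letter r) [0..<Suc k]) (cyclic_letter r k) = k div r + 1"
proof -
  have "count_list (map (cyclic_letter r) [0..<k]) (cyclic_letter r k) = k div r"
    using count_cyclic_letter[of "k mod r" r k] assms by (simp add: cyclic_letter_def)
  then show ?thesis by simp
qed

lemma adelman_T_cyclic:
  "adelman_T (q + 2) = map (cyclic_letter (q + 1)) [0..<q * (q + 1) + 2]"
proof -
  have "(q + 2)\<^sup>2 + 4 - 3 * (q + 2) = q * (q + 1) + 2"
    by (simp add: power2_eq_square algebra_simps)
  then show ?thesis
    using adelman_T_eq[of "q + 2"] by (simp add: cyclic_letter_def cong: map_cong)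
qed

text \<open>
  The \<open>i\<close>-th occurrence of the letter \<open>n - i = q + 2 - i\<close> lies in the \<open>i\<close>-th period, at offset
  \<open>q + 1 - i\<close>, so its position is \<open>(i - 1) * (q + 1) + (q + 1 - i) = i * q\<close>.
\<close>

lemma is_occurrence_adelman_T_iff:
  assumes "i \<in> {1..q}" and "k < q * (q + 1) + 2"
  shows "is_occurrence i (q + 2 - i) (adelman_T (q + 2)) k \<longleftrightarrow> k = i * q"
proof -
  have count: "count_list (take (Suc k) (adelman_T (q + 2))) (cyclic_letter (q + 1) k)
      = k div (q + 1) + 1"
    using count_cyclic_letter_self[of "q + 1" k] assms(2)
    unfolding adelman_T_cyclic take_map take_upt[of 0 "Suc k" "q * (q + 1) + 2"]
    by (simp add: take_map del: upt_Suc)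
  have len: "length (adelman_T (q + 2)) = q * (q + 1) + 2"
    unfolding adelman_T_cyclic by simp
  have nth: "adelman_T (q + 2) ! k = cyclic_letter (q + 1) k"
    unfolding adelman_T_cyclic using assms(2) by (simp del: upt_Suc)
  have "is_occurrence i (q + 2 - i) (adelman_T (q + 2)) k \<longleftrightarrow>
      cyclic_letter (q + 1) k = q + 2 - i \<and> k div (q + 1) + 1 = i"
    unfolding is_occurrence_def len nth using assms(2) count by metis
  also have "\<dots> \<longleftrightarrow> k mod (q + 1) = q + 1 - i \<and> k div (q + 1) = i - 1"
    using assms(1) by (auto simp: cyclic_letter_def)
  also have "\<dots> \<longleftrightarrow> k = i * q"
  proof -
    obtain j where j: "i = Suc j" using assms(1) by (cases i) auto
    obtain d where d: "q = j + d" using assms(1) j nat_le_iff_add[of j q] by auto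
    have "k = i * q \<longleftrightarrow> k = j * (q + 1) + d" by (simp add: j d algebra_simps)
    also have "\<dots> \<longleftrightarrow> k mod (q + 1) = d \<and> k div (q + 1) = j"
    proof
      assume "k = j * (q + 1) + d"
      moreover have "d < q + 1" by (simp add: d)
      ultimately show "k mod (q + 1) = d \<and> k div (q + 1) = j"
        by (metis add.commute add.right_neutral div_less div_mult_self1 mod_less
            mod_mult_self1 Suc_eq_plus1 nat.distinct(1))
    next
      assume "k mod (q + 1) = d \<and> k div (q + 1) = j"
      then show "k = j * (q + 1) + d" by (metis div_mult_mod_eq)
    qed
    finally show ?thesis by (simp add: j d)
  qed
  finally show ?thesis .
qed

lemma adelman_T'_eq:
  "adelman_T' (q + 2) =
    insert_after (q + 2) ((\<lambda>i. i * q) ` {1..q}) (cyclic_letter (q + 1)) [0..<q * (q + 1) + 2]"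
proof -
  let ?T = "adelman_T (q + 2)"
  have len: "length ?T = q * (q + 1) + 2" unfolding adelman_T_cyclic by simp
  have "adelman_T' (q + 2) = insert_after (q + 2)
      {k. \<exists>i \<in> {1..q}. is_occurrence i (q + 2 - i) ?T k} ((!) ?T) [0..<length ?T]"
    by (simp add: adelman_T'_def insert_after_def Let_def)
  also have "\<dots> = insert_after (q + 2) ((\<lambda>i. i * q) ` {1..q}) (cyclic_letter (q + 1)) [0..<length ?T]"
  proof (rule insert_after_cong)
    fix k assume "k \<in> set [0..<length ?T]"
    then have k: "k < q * (q + 1) + 2" unfolding len set_upt atLeastLessThan_iff by blast
    show "k \<in> {k. \<exists>i \<in> {1..q}. is_occurrence i (q + 2 - i) ?T k} \<longleftrightarrow> k \<in> (\<lambda>i. i * q) ` {1..q}"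
      using is_occurrence_adelman_T_iff[OF _ k] by blast
    show "?T ! k = cyclic_letter (q + 1) k"
      unfolding adelman_T_cyclic using k by (simp del: upt_Suc)
  qed
  finally show ?thesis unfolding len .
qed

lemma swap_last_two_append [simp]: "swap_last_two (xs @ [a, b]) = xs @ [b, a]"
  by (simp add: swap_last_two_def nth_append)

lemma swap_last_two_map:
  assumes "2 \<le> length xs"
  shows "swap_last_two (map f xs) = map f (swap_last_two xs)"
  using assms by (simp add: swap_last_two_def take_map)

text \<open>
  The interchange lets the final \<open>n\<close> take part in the pattern of the inserted ones: it becomes the
  copy after position \<open>(q + 1) * q\<close>.
\<close>

lemma swap_last_two_adelman_string:
  "swap_last_two (adelman_string (q + 2)) = (q + 2) #
    insert_after (q + 2) ((\<lambda>i. i * q) ` {1..q + 1}) (cyclic_letter (q + 1)) [0..<q * (q + 1) + 2]"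
proof -
  let ?c = "cyclic_letter (q + 1)" and ?M = "q * (q + 1)"
  let ?K = "(\<lambda>i. i * q) ` {1..q}" and ?K' = "(\<lambda>i. i * q) ` {1..q + 1}"
  have upt: "[0..<?M + 2] = [0..<?M] @ [?M, ?M + 1]" by simp
  have less: "i * q < ?M" if "i \<in> {1..q}" for i
  proof -
    have "i * q \<le> q * q" and "0 < q" using that by auto
    then show ?thesis unfolding distrib_left by linarith
  qed
  have K: "?M \<notin> ?K" "?M + 1 \<notin> ?K" using less by fastforce+
  have K'_eq: "?K' = insert ?M ?K"
    by (simp add: atLeastAtMostSuc_conv mult.commute)
  have K': "?M \<in> ?K'" "?M + 1 \<notin> ?K'" unfolding K'_eq using K by auto
  have "adelman_string (q + 2)
      = ((q + 2) # insert_after (q + 2) ?K ?c [0..<?M] @ [?c ?M]) @ [?c (?M + 1), q + 2]"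
    unfolding adelman_string_def adelman_T'_eq upt using K by simp
  then have "swap_last_two (adelman_string (q + 2))
      = (q + 2) # insert_after (q + 2) ?K ?c [0..<?M] @ [?c ?M, q + 2, ?c (?M + 1)]"
    by (simp only: swap_last_two_append) simp
  also have "insert_after (q + 2) ?K ?c [0..<?M] = insert_after (q + 2) ?K' ?c [0..<?M]"
    unfolding K'_eq by (rule insert_after_cong) auto
  finally show ?thesis unfolding upt using K' by simp
qed

section \<open>Completeness\<close>

lemma subseq_swap_last_two_adelman_string:
  assumes "p \<in> permutations_of_set {1..q + 2}"
  shows "subseq p (swap_last_two (adelman_string (q + 2)))"
proof -
  let ?n = "q + 2" and ?c = "cyclic_letter (q + 1)" and ?L = "q * (q + 1) + 2"
  let ?K = "(\<lambda>i. i * q) ` {1..q + 1}"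
  have set_p: "set p = {1..?n}" and dist: "distinct p"
    using assms by (auto dest: permutations_of_setD)
  have len: "length p = ?n" using distinct_card[OF dist] set_p by simp
  obtain xs ys where p: "p = xs @ ?n # ys"
    using set_p by (metis atLeastAtMost_iff le_add2 order_refl split_list one_le_numeral order_trans)
  have "set xs \<subseteq> {1..?n} - {?n}" "set ys \<subseteq> {1..?n} - {?n}"
    using set_p dist unfolding p by auto
  moreover have "{1..?n} - {?n} = {1..q + 1}" by auto
  ultimately have sets: "set xs \<subseteq> {1..q + 1}" "set ys \<subseteq> {1..q + 1}" by simp_all
  have adj: "distinct_adj xs" "distinct_adj ys"
    using dist unfolding p by (simp_all add: distinct_adj_altdef remdups_adj_distinct)
  define j where "j = length xs"
  have lengths: "j + length ys = q + 1" using len by (simp add: p j_def)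
  have total: "(j * q + 1) + length ys * q + 1 = ?L"
  proof -
    have "j * q + length ys * q = (q + 1) * q"
      by (simp only: lengths flip: add_mult_distrib)
    then show ?thesis by simp
  qed
  have "(j * q + 1) + length ys * (q + 1 - 1) + 1 \<le> ?L"
    using total by (simp only: add_diff_cancel_right' order_refl)
  with sets(2) adj(2) have "subseq ys (map ?c [j * q + 1..<?L])"
    by (rule subseq_cyclic_window)
  then have suffix: "subseq ys (insert_after ?n ?K ?c [j * q + 1..<?L])"
    using subseq_map_insert_after by (rule subseq_order.trans)
  have upt: "[0..<?L] = [0..<j * q + 1] @ [j * q + 1..<?L]"
    using upt_add_eq_append[of 0 "j * q + 1" "length ys * q + 1"] total
    by (simp only: add.assoc le0)
  have "subseq (xs @ ?n # ys) (?n # insert_after ?n ?K ?c [0..<?L])"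
  proof (cases "j = 0")
    \<comment> \<open>The leading \<open>n\<close> has no cyclic letter before it, so it is not an inserted copy.\<close>
    case True
    have "subseq ys (insert_after ?n ?K ?c [0..<?L])"
      unfolding upt insert_after_append by (rule list_emb_append2[OF suffix])
    then show ?thesis using True by (simp add: j_def)
  next
    case False
    then have marked: "j * q \<in> ?K" using lengths by auto
    have split: "insert_after ?n ?K ?c [0..<?L]
        = (insert_after ?n ?K ?c [0..<j * q] @ [?c (j * q)]) @ ?n # insert_after ?n ?K ?c [j * q + 1..<?L]"
      unfolding upt insert_after_append using marked by simp
    have "subseq xs (map ?c [0..<j * q + 1])"
      by (rule subseq_cyclic_window[OF sets(1) adj(1)]) (simp add: j_def)
    moreover have "subseq (map ?c [0..<j * q + 1]) (insert_after ?n ?K ?c [0..<j * q] @ [?c (j * q)])"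
      by (simp add: subseq_map_insert_after list_emb_append_mono)
    ultimately have "subseq xs (insert_after ?n ?K ?c [0..<j * q] @ [?c (j * q)])"
      by (rule subseq_order.trans)
    then have "subseq (xs @ ?n # ys) (insert_after ?n ?K ?c [0..<?L])"
      unfolding split using suffix by (intro list_emb_append_mono) auto
    then show ?thesis by (rule list_emb_Cons)
  qed
  then show ?thesis unfolding swap_last_two_adelman_string p .
qed

lemma set_swap_last_two_adelman_string: "set (swap_last_two (adelman_string (q + 2))) \<subseteq> {1..q + 2}"
proof -
  have "cyclic_letter (q + 1) k \<in> {1..q + 2}" for k
  proof -
    have "k mod (q + 1) < q + 1" by simp
    then show ?thesis unfolding cyclic_letter_def atLeastAtMost_iff by linarith
  qed
  then have "insert (q + 2) (cyclic_letter (q + 1) ` ks) \<subseteq> {1..q + 2}" for ks by auto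
  with set_insert_after_subset
  have "set (insert_after (q + 2) K (cyclic_letter (q + 1)) ks) \<subseteq> {1..q + 2}" for K ks
    by (rule subset_trans)
  then show ?thesis
    unfolding swap_last_two_adelman_string list.set(2)
    by (intro insert_subsetI) (simp only: atLeastAtMost_iff, simp)
qed

theorem theorem2p1:
  fixes n :: nat and A :: "'a set" and W :: "'a list"
  assumes "n \<ge> 2"
    and "adelman_generated n A W"
  shows "pi_complete A (swap_last_two W)"
proof -
  obtain q where n: "n = q + 2" using assms(1) by (metis add.commute le_Suc_ex)
  obtain f where f: "bij_betw f {1..n} A" and W: "W = map f (adelman_string n)"
    using assms(2) unfolding adelman_generated_def by blast
  have "2 \<le> length (adelman_string n)" by (simp add: adelman_string_def)
  then have swap: "swap_last_two W = map f (swap_last_two (adelman_string n))"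
    unfolding W by (rule swap_last_two_map)
  show ?thesis
    unfolding pi_complete_def
  proof (intro conjI ballI)
    show "set (swap_last_two W) \<subseteq> A"
      unfolding swap n using set_swap_last_two_adelman_string[of q] f
      by (auto simp: n bij_betw_def)
  next
    fix p assume p: "p \<in> permutations_of_set A"
    let ?p' = "map (inv_into {1..n} f) p"
    have "?p' \<in> permutations_of_set {1..n}"
      using p bij_betw_inv_into[OF f]
      by (auto simp: permutations_of_set_def distinct_map bij_betw_def)
    then have "subseq (map f ?p') (swap_last_two W)"
      unfolding swap n by (intro subseq_map subseq_swap_last_two_adelman_string)
    moreover have "map f ?p' = p"
      using p bij_betw_inv_into_right[OF f]
      by (auto simp: permutations_of_set_def intro!: map_idI)
    ultimately show "subseq p (swap_last_two W)" by simp
  qed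
qed

end
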